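(* Consider an integer linear program $\min\{c(x) : x\in\mathcal{X}\}$, where $\mathcal{X}$ is a set of $m\times n$ binary matrices, whose symmetry group is the group of all column permutations. Let $\tau$ be a branch-and-bound (B\&B) tree of this program in which static orbitopal fixing is performed and the branching rule is arbitrary. Then for each solution orbit $\mathcal{O}$ of the program, there is exactly one solution of $\mathcal{O}$ enumerated in the B\&B tree $\tau$.
   Context: Symmetry: the symmetry group is the symmetric group $\mathfrak{S}_n$ acting on columns: for every $x\in\mathcal{X}$ and every column permutation $\pi$, $\pi(x)\in\mathcal{X}$ and $c(\pi(x))=c(x)$. Solution orbits are the orbits of $\mathcal{X}$ under this action. Lexicographic order and full orbitope: for $y,z\in\{0,1\}^m$, $y\succeq z$ if $y=z$ or, at the first row where they differ, $y$ has a $1$ and $z$ a $0$. The full orbitope $\mathcal{P}_0(m,n)$ is the convex hull of all $m\times n$ binary matrices $X$ whose columns satisfy $X(j)\succeq X(j+1)$ for all $j<n$. For disjoint index sets $(I_0,I_1)$ the corresponding face of $[0,1]^{(m,n)}$ is $F=\{x : x_{i,j}=0\ \forall(i,j)\in I_0,\ x_{i,j}=1\ \forall (i,j)\in I_1\}$; $\mathrm{Fix}_F(P)$ is the smallest face of $[0,1]^{(m,n)}$ (possibly empty) containing $P\cap F\cap\{0,1\}^{(m,n)}$, and $(I_0^{\star},I_1^{\star})$ are the index sets giving it when non-empty. B\&B tree: each node $a$ corresponds to a subproblem obtained from the root by branching decisions and variable fixings; at a branched node a disjunction (a linear inequality $\lambda\cdot x\le k$ versus $\lambda\cdot x>k$,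 for instance $x_{i,j}=0\vee x_{i,j}=1$) splits the subproblem into two children. An arbitrary branching rule means any such disjunctions may be chosen. $B^a_0$ (resp. $B^a_1$) is the set of indices of variables previously fixed to $0$ (resp. $1$) at node $a$, and $F(a)$ is the face given by $(B^a_0,B^a_1)$. Apart from orbitopal fixing, nodes are discarded only when their subproblem is infeasible (pruning by cost bounds is disregarded), and branching proceeds until leaves, where all variables are fixed. A solution $x\in\mathcal{X}$ is enumerated in $\tau$ if it is the solution of some non-pruned leaf. Static orbitopal fixing: at the beginning of the processing of each node $a$ (leaves included), the face $\mathrm{Fix}_{F(a)}(\mathcal{P}_0(m,n))$ is computed; if it is empty, node $a$ is pruned; otherwise every variable $x_{i,j}$ with $(i,j)\in I_0^{\star}\setminus B^a_0$ is fixed to $0$ and every variable with $(i,j)\in I_1^{\star}\setminus B^a_1$ is fixed to $1$. *)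

theory Defs
  imports "HOL-Analysis.Analysis"
begin

text \<open>
  An m x n matrix is a vector of rows, with rows indexed by \<open>'m\<close> and columns by \<open>'n\<close>.
  Both index types are finite linear orders, so they stand for {1,...,m} and {1,...,n}.
\<close>

type_synonym ('m, 'n) real_matrix = "((real, 'n) vec, 'm) vec"

definition binary_matrices :: "('m::finite, 'n::finite) real_matrix set" where
  "binary_matrices = {x. \<forall>i j. x $ i $ j = 0 \<or> x $ i $ j = 1}"

definition unit_cube :: "('m::finite, 'n::finite) real_matrix set" where
  "unit_cube = {x. \<forall>i j. 0 \<le> x $ i $ j \<and> x $ i $ j \<le> 1}"


subsection \<open>Column permutations\<close>

definition permute_columns :: "('n::finite \<Rightarrow> 'n) \<Rightarrow> ('m::finite, 'n) real_matrix \<Rightarrow> ('m, 'n) real_matrix" where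
  "permute_columns \<pi> x = (\<chi> i j. x $ i $ inv \<pi> j)"

definition column_symmetric :: "('m::finite, 'n::finite) real_matrix set \<Rightarrow> (('m, 'n) real_matrix \<Rightarrow> real) \<Rightarrow> bool" where
  "column_symmetric X c \<longleftrightarrow>
     (\<forall>x\<in>X. \<forall>\<pi>. \<pi> permutes UNIV \<longrightarrow>
        permute_columns \<pi> x \<in> X \<and> c (permute_columns \<pi> x) = c x)"

definition solution_orbits :: "('m::finite, 'n::finite) real_matrix set \<Rightarrow> ('m, 'n) real_matrix set set" where
  "solution_orbits X = (\<lambda>x. {permute_columns \<pi> x | \<pi>. \<pi> permutes UNIV}) ` X"


subsection \<open>The full orbitope and fixing\<close>

definition lex_ge :: "(real, 'm::{finite,linorder}) vec \<Rightarrow> (real, 'm) vec \<Rightarrow> bool" where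
  "lex_ge y z \<longleftrightarrow>
     y = z \<or> (\<exists>i. (\<forall>i'<i. y $ i' = z $ i') \<and> y $ i = 1 \<and> z $ i = 0)"

definition next_index :: "'n::linorder \<Rightarrow> 'n \<Rightarrow> bool" where
  "next_index j j' \<longleftrightarrow> j < j' \<and> \<not> (\<exists>k. j < k \<and> k < j')"

definition full_orbitope :: "('m::{finite,linorder}, 'n::{finite,linorder}) real_matrix set" where
  "full_orbitope = convex hull
     {x \<in> binary_matrices. \<forall>j j'. next_index j j' \<longrightarrow> lex_ge (column j x) (column j' x)}"

text \<open>If the two index sets are not disjoint, then \<open>cube_face\<close> is empty.\<close>

definition cube_face :: "('m::finite \<times> 'n::finite) set \<Rightarrow> ('m \<times> 'n) set \<Rightarrow> ('m, 'n) real_matrix set" where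
  "cube_face I0 I1 =
     {x \<in> unit_cube. (\<forall>(i, j)\<in>I0. x $ i $ j = 0) \<and> (\<forall>(i, j)\<in>I1. x $ i $ j = 1)}"

text \<open>
  The \<open>hull\<close> is the intersection of all faces of the cube containing the given set. Faces are
  closed under intersection and the empty set counts as a face, so it is the smallest such face.
\<close>

definition fix_face :: "('m::finite, 'n::finite) real_matrix set \<Rightarrow> ('m, 'n) real_matrix set \<Rightarrow> ('m, 'n) real_matrix set" where
  "fix_face F P = (\<lambda>G. G face_of unit_cube) hull (P \<inter> F \<inter> binary_matrices)"


subsection \<open>Nodes\<close>

text \<open>The two sides of a disjunction: \<open>At_Most l k\<close> is l.x \<le> k and \<open>Exceeds l k\<close> is l.x > k.\<close>

datatype ('m::finite, 'n::finite) decision =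
    At_Most "('m, 'n) real_matrix" real
  | Exceeds "('m, 'n) real_matrix" real

fun satisfies :: "('m, 'n) real_matrix \<Rightarrow> ('m::finite, 'n::finite) decision \<Rightarrow> bool" where
  "satisfies x (At_Most l k) \<longleftrightarrow> l \<bullet> x \<le> k"
| "satisfies x (Exceeds l k) \<longleftrightarrow> l \<bullet> x > k"

record ('m, 'n) node =
  decisions :: "('m::finite, 'n::finite) decision set"
  fixed0 :: "('m \<times> 'n) set"
  fixed1 :: "('m \<times> 'n) set"

definition root :: "('m::finite, 'n::finite) node" where
  "root = \<lparr>decisions = {}, fixed0 = {}, fixed1 = {}\<rparr>"

definition node_face :: "('m::finite, 'n::finite) node \<Rightarrow> ('m, 'n) real_matrix set" where
  "node_face a = cube_face (fixed0 a) (fixed1 a)"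

definition subproblem :: "('m, 'n) real_matrix set \<Rightarrow> ('m::finite, 'n::finite) node \<Rightarrow> ('m, 'n) real_matrix set" where
  "subproblem X a = {x \<in> X \<inter> node_face a. \<forall>d\<in>decisions a. satisfies x d}"

definition all_fixed :: "('m::finite, 'n::finite) node \<Rightarrow> bool" where
  "all_fixed a \<longleftrightarrow> fixed0 a \<union> fixed1 a = UNIV"

definition orbitope_fix_face ::
  "('m::{finite,linorder}, 'n::{finite,linorder}) node \<Rightarrow> ('m, 'n) real_matrix set" where
  "orbitope_fix_face a = fix_face (node_face a) full_orbitope"

text \<open>
  \<open>orbitopal_fixing a a'\<close>: node \<open>a\<close> is not pruned by orbitopal fixing, and \<open>a'\<close> is the result of
  applying the fixings. The index sets \<open>I0\<close>, \<open>I1\<close> are unique because the face is nonempty.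
\<close>

definition orbitopal_fixing ::
  "('m::{finite,linorder}, 'n::{finite,linorder}) node \<Rightarrow> ('m, 'n) node \<Rightarrow> bool" where
  "orbitopal_fixing a a' \<longleftrightarrow>
     orbitope_fix_face a \<noteq> {} \<and>
     (\<exists>I0 I1. I0 \<inter> I1 = {} \<and> cube_face I0 I1 = orbitope_fix_face a \<and>
        a' = a\<lparr>fixed0 := fixed0 a \<union> (I0 - fixed0 a), fixed1 := fixed1 a \<union> (I1 - fixed1 a)\<rparr>)"

text \<open>The variables to which the decision by itself leaves only the value \<open>v\<close>.\<close>

definition decided :: "real \<Rightarrow> ('m::finite, 'n::finite) decision \<Rightarrow> ('m \<times> 'n) set" where
  "decided v d = {(i, j). \<forall>x\<in>binary_matrices. satisfies x d \<longrightarrow> x $ i $ j = v}"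

text \<open>
  A child inherits the decisions and fixings of its parent and adds the decision \<open>d\<close>. Every variable
  that \<open>d\<close> sets directly becomes fixed; in particular, x_ij = 0 or x_ij = 1 is the disjunction whose
  vector l is the (i,j) unit matrix, with k = 0. As l is arbitrary, a variable can also become
  determined by several decisions, or by a decision together with the constraints. Such a
  variable may be recorded as fixed as well, but only to a value it takes at every solution
  of the child subproblem.
\<close>

definition child ::
  "('m, 'n) real_matrix set \<Rightarrow> ('m::finite, 'n::finite) decision \<Rightarrow> ('m, 'n) node \<Rightarrow> ('m, 'n) node \<Rightarrow> bool" where
  "child X d a b \<longleftrightarrow>
     decisions b = insert d (decisions a) \<and>
     fixed0 a \<union> decided 0 d \<subseteq> fixed0 b \<and>
     fixed1 a \<union> decided 1 d \<subseteq> fixed1 b \<and>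
     (\<forall>x\<in>subproblem X a. satisfies x d \<longrightarrow>
        (\<forall>(i, j)\<in>fixed0 b. x $ i $ j = 0) \<and> (\<forall>(i, j)\<in>fixed1 b. x $ i $ j = 1))"


subsection \<open>Branch-and-bound trees with static orbitopal fixing\<close>

datatype ('m::finite, 'n::finite) bb_tree =
    Pruned "('m, 'n) node"
  | Leaf "('m, 'n) node"
  | Branch "('m, 'n) node" "('m, 'n) bb_tree" "('m, 'n) bb_tree"

text \<open>
  \<open>bb_subtree X a t\<close>: processing the node \<open>a\<close>, and then its descendants, yields the tree \<open>t\<close>.
  A leaf or branched node is stored after its fixings have been applied. Infeasibility may be
  detected at any node, but need not be before all variables are fixed.
\<close>

inductive bb_subtree ::
  "('m, 'n) real_matrix set \<Rightarrow> ('m::{finite,linorder}, 'n::{finite,linorder}) node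
     \<Rightarrow> ('m, 'n) bb_tree \<Rightarrow> bool" for X where
  prune_orbitopal:
    "orbitope_fix_face a = {} \<Longrightarrow> bb_subtree X a (Pruned a)"
| prune_infeasible:
    "subproblem X a = {} \<Longrightarrow> bb_subtree X a (Pruned a)"
| prune_infeasible_fixed:
    "orbitopal_fixing a a' \<Longrightarrow> subproblem X a' = {} \<Longrightarrow> bb_subtree X a (Pruned a')"
| leaf:
    "orbitopal_fixing a a' \<Longrightarrow> all_fixed a' \<Longrightarrow> subproblem X a' \<noteq> {} \<Longrightarrow>
     bb_subtree X a (Leaf a')"
| branch:
    "orbitopal_fixing a a' \<Longrightarrow> \<not> all_fixed a' \<Longrightarrow>
     child X (At_Most l k) a' b \<Longrightarrow> bb_subtree X b t \<Longrightarrow>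
     child X (Exceeds l k) a' b' \<Longrightarrow> bb_subtree X b' t' \<Longrightarrow>
     bb_subtree X a (Branch a' t t')"

definition orbitopal_fixing_bb_tree ::
  "('m, 'n) real_matrix set \<Rightarrow> ('m::{finite,linorder}, 'n::{finite,linorder}) bb_tree \<Rightarrow> bool" where
  "orbitopal_fixing_bb_tree X \<tau> \<longleftrightarrow> bb_subtree X root \<tau>"

fun leaves :: "('m::finite, 'n::finite) bb_tree \<Rightarrow> ('m, 'n) node set" where
  "leaves (Pruned a) = {}"
| "leaves (Leaf a) = {a}"
| "leaves (Branch a t t') = leaves t \<union> leaves t'"

definition enumerated ::
  "('m, 'n) real_matrix set \<Rightarrow> ('m::finite, 'n::finite) bb_tree \<Rightarrow> ('m, 'n) real_matrix \<Rightarrow> bool" where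
  "enumerated X \<tau> x \<longleftrightarrow> (\<exists>a\<in>leaves \<tau>. subproblem X a = {x})"

end

theory Submission imports Defs begin

text \<open>
  The enumerated solutions are exactly the solutions whose columns are in non-increasing
  lexicographic order (\<open>enumerated_iff_ordered\<close>), and each orbit contains exactly one such matrix.

  An ordered solution is never lost: it is a binary point of the orbitope, so it lies in the face
  computed by orbitopal fixing at every node whose subproblem contains it, and at a branching it
  satisfies one side of the disjunction. Hence it reaches a leaf. Conversely, the face computed
  at a leaf is nonempty, so it contains a binary point of the orbitope; this point obeys all the
  fixings of the leaf. As these determine every entry, it is the solution of the leaf. A binary
  point of the orbitope is ordered because binary matrices are extreme points of the cube.

  That each orbit has exactly one ordered member is the statement that a finite family in a linear
  order has exactly one sorted rearrangement. It is applied to the family of columns, each being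
  replaced by its position in the lexicographic order of the binary vectors, a natural number.
\<close>

section \<open>Sorted rearrangements of finite families\<close>

lemma mono_if_mono_on_next_index:
  fixes k :: "'n::{finite,linorder} \<Rightarrow> 'b::order"
  assumes step: "\<And>j j'. next_index j j' \<Longrightarrow> k j \<le> k j'"
  shows "mono k"
proof (rule monoI)
  fix j j' :: 'n
  assume "j \<le> j'"
  then show "k j \<le> k j'"
  proof (induction "card {j<..j'}" arbitrary: j rule: less_induct)
    case less
    show ?case
    proof (cases "j = j'")
      case False
      with less.prems have "j' \<in> {j<..j'}" by simp
      define i where "i = Min {j<..j'}"
      have i: "i \<in> {j<..j'}"
        unfolding i_def using \<open>j' \<in> {j<..j'}\<close> by (intro Min_in) auto
      have least: "i \<le> l" if "l \<in> {j<..j'}" for l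
        unfolding i_def using that by (intro Min_le) auto
      have "next_index j i"
        unfolding next_index_def using i least by fastforce
      then have "k j \<le> k i" by (rule step)
      moreover have "{i<..j'} \<subset> {j<..j'}" using i by auto
      then have "card {i<..j'} < card {j<..j'}" by (intro psubset_card_mono) auto
      then have "k i \<le> k j'" using i by (intro less.hyps) auto
      ultimately show ?thesis by (rule order_trans)
    qed simp
  qed
qed

lemma exists_sorting_permutation:
  fixes k :: "'n::{finite,linorder} \<Rightarrow> 'b::linorder"
  shows "\<exists>\<sigma>. \<sigma> permutes UNIV \<and> mono (k \<circ> \<sigma>)"
proof -
  define js where "js = sorted_list_of_set (UNIV :: 'n set)"
  define ks where "ks = sort_key k js"
  define N where "N = length js"
  have js: "sorted js" "distinct js" "set js = UNIV"
    unfolding js_def by simp_all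
  have ks: "sorted (map k ks)" "distinct ks" "set ks = UNIV" "length ks = N"
    unfolding ks_def N_def using js by simp_all
  have bj: "bij_betw ((!) js) {..<N} UNIV"
    using js by (intro bij_betw_nth) (simp_all add: N_def)
  have bk: "bij_betw ((!) ks) {..<N} UNIV"
    using ks by (intro bij_betw_nth) simp_all
  define pos where "pos = inv_into {..<N} ((!) js)"
  have bp: "bij_betw pos UNIV {..<N}"
    unfolding pos_def by (rule bij_betw_inv_into[OF bj])
  have pos: "pos j < N" "js ! pos j = j" for j
    using bij_betw_apply[OF bp, of j] bij_betw_inv_into_right[OF bj, of j]
    by (simp_all add: pos_def)
  have "bij (((!) ks) \<circ> pos)" by (rule bij_betw_trans[OF bp bk])
  then have "((!) ks) \<circ> pos permutes UNIV" by (intro bij_imp_permutes) auto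
  moreover have "mono (k \<circ> ((!) ks \<circ> pos))"
  proof (rule monoI)
    fix j j' :: 'n
    assume "j \<le> j'"
    have "pos j \<le> pos j'"
    proof (rule ccontr)
      assume "\<not> pos j \<le> pos j'"
      then have "js ! pos j' \<le> js ! pos j"
        using js(1) pos(1)[of j] by (intro sorted_nth_mono) (simp_all add: N_def)
      with \<open>j \<le> j'\<close> have "j = j'" by (simp add: pos(2))
      with \<open>\<not> pos j \<le> pos j'\<close> show False by simp
    qed
    then have "map k ks ! pos j \<le> map k ks ! pos j'"
      using ks pos(1)[of j'] by (intro sorted_nth_mono) simp_all
    then show "(k \<circ> ((!) ks \<circ> pos)) j \<le> (k \<circ> ((!) ks \<circ> pos)) j'"
      using ks(4) pos(1)[of j] pos(1)[of j'] by simp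
  qed
  ultimately show ?thesis by blast
qed

text \<open>
  The sets \<open>{j. k j \<le> v}\<close> and \<open>{j. k (\<sigma> j) \<le> v}\<close> have the same cardinality, and by monotonicity
  both are initial segments, so they coincide for every \<open>v\<close>.
\<close>

lemma mono_rearrangement_unique:
  fixes k :: "'n::{finite,linorder} \<Rightarrow> 'b::linorder"
  assumes "mono k" and "mono (k \<circ> \<sigma>)" and \<sigma>: "\<sigma> permutes UNIV"
  shows "k \<circ> \<sigma> = k"
proof -
  have level: "{j. k (\<sigma> j) \<le> v} = {j. k j \<le> v}" (is "?A = ?B") for v
  proof -
    have "bij \<sigma>" using \<sigma> by (rule permutes_bij)
    have "\<sigma> ` ?A = ?B"
      using bij_is_surj[OF \<open>bij \<sigma>\<close>] by (auto simp: image_iff)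
    then have "card ?A = card ?B"
      using card_image[OF inj_on_subset[OF bij_is_inj[OF \<open>bij \<sigma>\<close>]], of ?A] by simp
    moreover have "?A \<subseteq> ?B \<or> ?B \<subseteq> ?A"
    proof (rule ccontr)
      assume "\<not> ?thesis"
      then obtain a b where ab: "k (\<sigma> a) \<le> v" "\<not> k a \<le> v" "k b \<le> v" "\<not> k (\<sigma> b) \<le> v"
        by auto
      consider "a \<le> b" | "b \<le> a" by (rule linear[THEN disjE])
      then show False
      proof cases
        case 1
        then have "k a \<le> k b" by (rule monoD[OF \<open>mono k\<close>])
        with ab show False by simp
      next
        case 2
        then have "k (\<sigma> b) \<le> k (\<sigma> a)" using monoD[OF \<open>mono (k \<circ> \<sigma>)\<close>] by fastforce
        with ab show False by simp
      qed
    qed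
    ultimately show ?thesis
      using card_subset_eq[of ?B ?A] card_subset_eq[of ?A ?B] by (metis finite)
  qed
  show ?thesis
  proof
    fix j
    have "k j \<le> k (\<sigma> j)" using level[of "k (\<sigma> j)"] by blast
    moreover have "k (\<sigma> j) \<le> k j" using level[of "k j"] by blast
    ultimately show "(k \<circ> \<sigma>) j = k j" by simp
  qed
qed

section \<open>The lexicographic order on binary vectors\<close>

definition binary_vectors :: "((real, 'm::finite) vec) set" where
  "binary_vectors = {v. \<forall>i. v $ i = 0 \<or> v $ i = 1}"

lemma finite_binary_vectors: "finite (binary_vectors :: (real, 'm::finite) vec set)"
proof (rule finite_subset)
  show "binary_vectors \<subseteq> range (\<lambda>A :: 'm set. \<chi> i. if i \<in> A then 1 else (0 :: real))"
  proof
    fix v :: "(real, 'm) vec"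
    assume "v \<in> binary_vectors"
    then have "v = (\<chi> i. if i \<in> {i. v $ i = 1} then 1 else 0)"
      by (auto simp: vec_eq_iff binary_vectors_def)
    then show "v \<in> range (\<lambda>A. \<chi> i. if i \<in> A then 1 else 0)" by (rule range_eqI)
  qed
qed simp

lemma column_binary: "x \<in> binary_matrices \<Longrightarrow> column j x \<in> binary_vectors"
  by (simp add: binary_matrices_def binary_vectors_def column_def)

lemma lex_ge_refl: "lex_ge v v"
  by (simp add: lex_ge_def)

lemma lex_ge_total:
  assumes "v \<in> binary_vectors" and "w \<in> binary_vectors"
  shows "lex_ge v w \<or> lex_ge w v"
proof (cases "v = w")
  case False
  define D where "D = {i. v $ i \<noteq> w $ i}"
  have "D \<noteq> {}" using False by (auto simp: D_def vec_eq_iff)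
  then have "Min D \<in> D" by (intro Min_in) auto
  then have differ: "v $ Min D \<noteq> w $ Min D" by (simp add: D_def)
  have agree: "v $ i = w $ i" if "i < Min D" for i
  proof (rule ccontr)
    assume "v $ i \<noteq> w $ i"
    then have "Min D \<le> i" by (intro Min_le) (auto simp: D_def)
    with that show False by simp
  qed
  have "v $ Min D = 1 \<and> w $ Min D = 0 \<or> w $ Min D = 1 \<and> v $ Min D = 0"
    using differ assms[unfolded binary_vectors_def, THEN CollectD, THEN spec[of _ "Min D"]]
    by auto
  then show ?thesis
    unfolding lex_ge_def using agree by metis
qed (simp add: lex_ge_refl)

lemma lex_ge_antisym:
  assumes "lex_ge v w" and "lex_ge w v"
  shows "v = w"
proof (rule ccontr)
  assume "v \<noteq> w"
  with assms obtain i i' where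
    i: "\<forall>l<i. v $ l = w $ l" "v $ i = 1" "w $ i = 0" and
    i': "\<forall>l<i'. w $ l = v $ l" "w $ i' = 1" "v $ i' = 0"
    unfolding lex_ge_def by auto
  then show False
    by (cases i i' rule: linorder_cases) auto
qed

lemma lex_ge_trans:
  assumes "lex_ge u v" and "lex_ge v w"
  shows "lex_ge u w"
proof (cases "u = v \<or> v = w")
  case False
  with assms obtain i i' where
    i: "\<forall>l<i. u $ l = v $ l" "u $ i = 1" "v $ i = 0" and
    i': "\<forall>l<i'. v $ l = w $ l" "v $ i' = 1" "w $ i' = 0"
    unfolding lex_ge_def by auto
  have "\<forall>l<min i i'. u $ l = w $ l" using i i' by simp
  moreover have "u $ min i i' = 1 \<and> w $ min i i' = 0"
    using i i' by (cases i i' rule: linorder_cases) (auto simp: min_def)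
  ultimately show ?thesis unfolding lex_ge_def by blast
qed (use assms in auto)

text \<open>
  Position in the decreasing enumeration of the binary vectors. As the vectors carry another order
  already, this embedding into the natural numbers makes the facts on sorting available for
  \<^const>\<open>lex_ge\<close>.
\<close>

definition lex_rank :: "(real, 'm::{finite,linorder}) vec \<Rightarrow> nat" where
  "lex_rank v = card {u \<in> binary_vectors. lex_ge u v}"

lemma lex_rank_le_iff:
  assumes v: "v \<in> binary_vectors" and w: "w \<in> binary_vectors"
  shows "lex_rank v \<le> lex_rank w \<longleftrightarrow> lex_ge v w"
proof -
  let ?up = "\<lambda>v. {u \<in> binary_vectors. lex_ge u v}"
  have fin: "finite (?up u)" for u
    using finite_binary_vectors by (rule rev_finite_subset) auto
  have up_mono: "?up v \<subseteq> ?up w" if "lex_ge v w" for v w :: "(real, 'a) vec"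
    using that lex_ge_trans by blast
  show ?thesis
  proof
    assume "lex_ge v w"
    then show "lex_rank v \<le> lex_rank w"
      unfolding lex_rank_def using fin up_mono by (intro card_mono) auto
  next
    assume le: "lex_rank v \<le> lex_rank w"
    show "lex_ge v w"
    proof (cases "lex_ge w v")
      case True
      then have "?up w \<subseteq> ?up v" by (rule up_mono)
      then have "?up w = ?up v"
        using fin le unfolding lex_rank_def by (intro card_seteq) auto
      then show ?thesis using v lex_ge_refl by blast
    next
      case False
      then show ?thesis using lex_ge_total[OF v w] by blast
    qed
  qed
qed

lemma inj_on_lex_rank: "inj_on lex_rank binary_vectors"
  by (intro inj_onI lex_ge_antisym) (simp_all flip: lex_rank_le_iff)

section \<open>The ordered member of an orbit\<close>

definition ordered_matrices :: "('m::{finite,linorder}, 'n::{finite,linorder}) real_matrix set" where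
  "ordered_matrices =
     {x \<in> binary_matrices. \<forall>j j'. next_index j j' \<longrightarrow> lex_ge (column j x) (column j' x)}"

lemma ordered_iff_mono_rank:
  assumes "x \<in> binary_matrices"
  shows "x \<in> ordered_matrices \<longleftrightarrow> mono (\<lambda>j. lex_rank (column j x))"
proof
  assume "x \<in> ordered_matrices"
  then show "mono (\<lambda>j. lex_rank (column j x))"
    by (intro mono_if_mono_on_next_index)
       (simp add: ordered_matrices_def lex_rank_le_iff column_binary)
next
  assume mono: "mono (\<lambda>j. lex_rank (column j x))"
  have "lex_ge (column j x) (column j' x)" if "next_index j j'" for j j'
  proof -
    have "j \<le> j'" using that by (auto simp: next_index_def)
    then have "lex_rank (column j x) \<le> lex_rank (column j' x)" by (rule monoD[OF mono])
    then show ?thesis using assms by (simp add: lex_rank_le_iff column_binary)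
  qed
  then show "x \<in> ordered_matrices" using assms by (simp add: ordered_matrices_def)
qed

lemma column_permute_columns: "column j (permute_columns \<pi> x) = column (inv \<pi> j) x"
  by (simp add: column_def permute_columns_def)

lemma permute_columns_binary:
  "x \<in> binary_matrices \<Longrightarrow> permute_columns \<pi> x \<in> binary_matrices"
  by (simp add: binary_matrices_def permute_columns_def)

lemma exists_ordered_permutation:
  assumes "x \<in> binary_matrices"
  shows "\<exists>\<pi>. \<pi> permutes UNIV \<and> permute_columns \<pi> x \<in> ordered_matrices"
proof -
  obtain \<sigma> where \<sigma>: "\<sigma> permutes UNIV" "mono ((\<lambda>j. lex_rank (column j x)) \<circ> \<sigma>)"
    using exists_sorting_permutation by blast
  have "permute_columns (inv \<sigma>) x \<in> ordered_matrices"
    using \<sigma> assms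
    by (simp add: ordered_iff_mono_rank permute_columns_binary column_permute_columns
          permutes_inv_inv comp_def)
  then show ?thesis using permutes_inv[OF \<sigma>(1)] by blast
qed

lemma ordered_permutation_unique:
  assumes x: "x \<in> binary_matrices"
    and \<pi>: "\<pi> permutes UNIV" and \<rho>: "\<rho> permutes UNIV"
    and ord: "permute_columns \<pi> x \<in> ordered_matrices" "permute_columns \<rho> x \<in> ordered_matrices"
  shows "permute_columns \<pi> x = permute_columns \<rho> x"
proof -
  let ?k = "\<lambda>\<pi> j. lex_rank (column j (permute_columns \<pi> x))"
  have mono: "mono (?k \<pi>)" "mono (?k \<rho>)"
    using ord x by (simp_all add: ordered_iff_mono_rank permute_columns_binary)
  have k_\<rho>: "?k \<rho> = ?k \<pi> \<circ> (\<pi> \<circ> inv \<rho>)"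
    using permutes_inverses(2)[OF \<pi>] by (simp add: fun_eq_iff column_permute_columns)
  have "\<pi> \<circ> inv \<rho> permutes UNIV"
    using permutes_compose[OF permutes_inv[OF \<rho>] \<pi>] .
  then have "?k \<rho> = ?k \<pi>"
    using mono_rearrangement_unique[OF mono(1)] mono(2) k_\<rho> by metis
  then have "column j (permute_columns \<rho> x) = column j (permute_columns \<pi> x)" for j
    using inj_onD[OF inj_on_lex_rank] column_binary permute_columns_binary[OF x] by metis
  then show ?thesis by (simp add: vec_eq_iff column_def)
qed

section \<open>Binary points of the orbitope\<close>

lemma full_orbitope_eq: "full_orbitope = convex hull ordered_matrices"
  by (simp add: full_orbitope_def ordered_matrices_def)

lemma binary_subset_unit_cube: "binary_matrices \<subseteq> unit_cube"
  unfolding binary_matrices_def unit_cube_def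
  by (intro Collect_mono impI allI) (metis order_refl zero_le_one)

lemma convex_unit_cube: "convex (unit_cube :: ('m::finite, 'n::finite) real_matrix set)"
proof (rule convexI)
  fix x y :: "('m, 'n) real_matrix" and u v :: real
  assume x: "x \<in> unit_cube" and y: "y \<in> unit_cube" and uv: "0 \<le> u" "0 \<le> v" "u + v = 1"
  have "0 \<le> u * x $ i $ j + v * y $ i $ j \<and> u * x $ i $ j + v * y $ i $ j \<le> 1" for i j
    using x y uv unfolding unit_cube_def
    by (intro conjI add_nonneg_nonneg mult_nonneg_nonneg convex_bound_le) simp_all
  then show "u *\<^sub>R x + v *\<^sub>R y \<in> unit_cube"
    by (simp add: unit_cube_def)
qed

lemma binary_extreme_point_of_unit_cube:
  assumes x: "x \<in> binary_matrices"
  shows "x extreme_point_of unit_cube"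
  unfolding extreme_point_of_def
proof (intro conjI ballI notI)
  show "x \<in> unit_cube" using x binary_subset_unit_cube by blast
next
  fix a b
  assume a: "a \<in> unit_cube" and b: "b \<in> unit_cube" and "x \<in> open_segment a b"
  then obtain u where "a \<noteq> b" and u: "0 < u" "u < 1" and xu: "x = (1 - u) *\<^sub>R a + u *\<^sub>R b"
    by (auto simp: in_segment)
  have "a $ i $ j = b $ i $ j" for i j
  proof -
    have bounds: "0 \<le> a $ i $ j" "a $ i $ j \<le> 1" "0 \<le> b $ i $ j" "b $ i $ j \<le> 1"
      using a b by (simp_all add: unit_cube_def)
    have comb: "x $ i $ j = (1 - u) * a $ i $ j + u * b $ i $ j"
      by (simp add: xu)
    consider "x $ i $ j = 0" | "x $ i $ j = 1" using x by (auto simp: binary_matrices_def)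
    then show ?thesis
    proof cases
      case 1
      have "0 \<le> (1 - u) * a $ i $ j" "0 \<le> u * b $ i $ j" using bounds u by simp_all
      with 1 comb have "(1 - u) * a $ i $ j = 0" "u * b $ i $ j = 0" by linarith+
      with u show ?thesis by simp
    next
      case 2
      have "0 \<le> (1 - u) * (1 - a $ i $ j)" "0 \<le> u * (1 - b $ i $ j)" using bounds u by simp_all
      moreover have "(1 - u) * (1 - a $ i $ j) + u * (1 - b $ i $ j) = 0"
        using 2 comb by (simp add: algebra_simps)
      ultimately have "(1 - u) * (1 - a $ i $ j) = 0" "u * (1 - b $ i $ j) = 0" by linarith+
      with u show ?thesis by simp
    qed
  qed
  with \<open>a \<noteq> b\<close> show False by (simp add: vec_eq_iff)
qed

lemma binary_in_full_orbitope_iff: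
  assumes x: "x \<in> binary_matrices"
  shows "x \<in> full_orbitope \<longleftrightarrow> x \<in> ordered_matrices"
proof
  assume "x \<in> full_orbitope"
  then have mem: "x \<in> convex hull ordered_matrices" by (simp add: full_orbitope_eq)
  have "ordered_matrices \<subseteq> unit_cube"
    using binary_subset_unit_cube by (auto simp: ordered_matrices_def)
  then have "convex hull ordered_matrices \<subseteq> unit_cube"
    by (rule hull_minimal) (rule convex_unit_cube)
  then have "x extreme_point_of (convex hull ordered_matrices)"
    using binary_extreme_point_of_unit_cube[OF x] mem unfolding extreme_point_of_def by blast
  then show "x \<in> ordered_matrices" by (rule extreme_point_of_convex_hull)
next
  assume "x \<in> ordered_matrices"
  then show "x \<in> full_orbitope" unfolding full_orbitope_eq by (rule hull_inc)
qed

section \<open>Orbitopal fixing\<close>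

lemma ordered_in_orbitope_fix_face:
  assumes "x \<in> ordered_matrices" and "x \<in> node_face a"
  shows "x \<in> orbitope_fix_face a"
proof -
  have "x \<in> binary_matrices" using assms(1) by (simp add: ordered_matrices_def)
  with assms show ?thesis
    unfolding orbitope_fix_face_def fix_face_def
    by (intro hull_inc) (simp add: binary_in_full_orbitope_iff)
qed

lemma orbitope_fix_face_nonemptyE:
  assumes "orbitope_fix_face a \<noteq> {}"
  obtains y where "y \<in> ordered_matrices" and "y \<in> node_face a"
proof -
  \<comment> \<open>The empty set is a face of the cube, hence the hull of the empty set is empty.\<close>
  have "full_orbitope \<inter> node_face a \<inter> binary_matrices \<noteq> {}"
  proof
    assume "full_orbitope \<inter> node_face a \<inter> binary_matrices = {}"
    then have "orbitope_fix_face a \<subseteq> {}"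
      unfolding orbitope_fix_face_def fix_face_def by (intro hull_minimal) auto
    with assms show False by simp
  qed
  then show thesis using that binary_in_full_orbitope_iff by blast
qed

lemma orbitopal_fixing_node_face:
  assumes "orbitopal_fixing a a'" and "x \<in> node_face a" and "x \<in> orbitope_fix_face a"
  shows "x \<in> node_face a'"
proof -
  obtain I0 I1 where I: "cube_face I0 I1 = orbitope_fix_face a" and
    a': "a' = a\<lparr>fixed0 := fixed0 a \<union> (I0 - fixed0 a), fixed1 := fixed1 a \<union> (I1 - fixed1 a)\<rparr>"
    using assms(1) unfolding orbitopal_fixing_def by blast
  have "x \<in> cube_face I0 I1" using I assms(3) by simp
  with assms(2) show ?thesis by (auto simp: a' node_face_def cube_face_def)
qed

lemma orbitopal_fixing_keeps_ordered_solution: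
  assumes fixing: "orbitopal_fixing a a'" and x: "x \<in> ordered_matrices" "x \<in> subproblem X a"
  shows "x \<in> subproblem X a'"
proof -
  have "x \<in> node_face a" using x(2) by (simp add: subproblem_def)
  then have "x \<in> node_face a'"
    using orbitopal_fixing_node_face[OF fixing] ordered_in_orbitope_fix_face x(1) by blast
  moreover have "decisions a' = decisions a"
    using fixing by (auto simp: orbitopal_fixing_def)
  ultimately show ?thesis using x(2) by (simp add: subproblem_def)
qed

lemma all_fixed_node_face_unique:
  assumes "all_fixed a" and "x \<in> node_face a" and "y \<in> node_face a"
  shows "x = y"
proof -
  have "x $ i $ j = y $ i $ j" for i j
  proof -
    have "(i, j) \<in> fixed0 a \<union> fixed1 a" using assms(1) by (simp add: all_fixed_def)
    then show ?thesis using assms(2,3) unfolding node_face_def cube_face_def by fastforce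
  qed
  then show ?thesis by (simp add: vec_eq_iff)
qed

text \<open>
  This is what performing orbitopal fixing at the leaves achieves. The face at \<open>a\<close> is defined from
  binary points of the orbitope alone, so some ordered matrix survives the fixings, whether or not
  it satisfies the decisions made at \<open>a\<close> or the constraints; no other matrix can then survive.
\<close>

lemma all_fixed_leaf_ordered:
  assumes fixing: "orbitopal_fixing a a'" and "all_fixed a'" and "x \<in> node_face a'"
  shows "x \<in> ordered_matrices"
proof -
  obtain y where y: "y \<in> ordered_matrices" "y \<in> node_face a"
    using fixing orbitope_fix_face_nonemptyE unfolding orbitopal_fixing_def by blast
  then have "y \<in> node_face a'"
    using orbitopal_fixing_node_face[OF fixing] ordered_in_orbitope_fix_face by blast
  with assms y(1) show ?thesis using all_fixed_node_face_unique by blast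
qed

section \<open>Enumerated solutions\<close>

lemma leaf_of_bb_subtree:
  assumes "bb_subtree X a t" and "b \<in> leaves t"
  shows "\<exists>a'. orbitopal_fixing a' b \<and> all_fixed b"
  using assms by induction auto

lemma child_keeps_solution:
  assumes child: "child X d a b" and x: "x \<in> subproblem X a" and "satisfies x d"
  shows "x \<in> subproblem X b"
proof -
  have "(\<forall>(i, j)\<in>fixed0 b. x $ i $ j = 0) \<and> (\<forall>(i, j)\<in>fixed1 b. x $ i $ j = 1)"
    using assms unfolding child_def by blast
  moreover have "x \<in> unit_cube"
    using x unfolding subproblem_def node_face_def cube_face_def by blast
  ultimately have "x \<in> node_face b"
    unfolding node_face_def cube_face_def by blast
  moreover have "decisions b = insert d (decisions a)"
    using child unfolding child_def by (rule conjunct1)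
  ultimately show ?thesis
    using x \<open>satisfies x d\<close> unfolding subproblem_def by simp
qed

lemma ordered_solution_enumerated:
  assumes "bb_subtree X a t" and "x \<in> ordered_matrices" and "x \<in> subproblem X a"
  shows "enumerated X t x"
  using assms
proof induction
  case (prune_orbitopal a)
  then have "x \<in> orbitope_fix_face a"
    by (intro ordered_in_orbitope_fix_face) (simp_all add: subproblem_def)
  with prune_orbitopal show ?case by simp
next
  case (prune_infeasible a)
  then show ?case by simp
next
  case (prune_infeasible_fixed a a')
  then show ?case using orbitopal_fixing_keeps_ordered_solution by blast
next
  case (leaf a a')
  then have x: "x \<in> subproblem X a'" using orbitopal_fixing_keeps_ordered_solution by blast
  have "y = x" if "y \<in> subproblem X a'" for y
    using that x all_fixed_node_face_unique[OF leaf.hyps(2)] by (simp add: subproblem_def)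
  with x have "subproblem X a' = {x}" by blast
  then show ?case by (simp add: enumerated_def)
next
  case (branch a a' l k b t b' t')
  then have x: "x \<in> subproblem X a'" using orbitopal_fixing_keeps_ordered_solution by blast
  have "enumerated X t x \<or> enumerated X t' x"
  proof (cases "l \<bullet> x \<le> k")
    case True
    then have "x \<in> subproblem X b"
      using child_keeps_solution[OF \<open>child X (At_Most l k) a' b\<close> x] by simp
    then show ?thesis using branch by blast
  next
    case False
    then have "x \<in> subproblem X b'"
      using child_keeps_solution[OF \<open>child X (Exceeds l k) a' b'\<close> x] by simp
    then show ?thesis using branch by blast
  qed
  then show ?case by (auto simp: enumerated_def)
qed

lemma enumerated_iff_ordered:
  assumes X: "X \<subseteq> binary_matrices" and tree: "orbitopal_fixing_bb_tree X \<tau>"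
  shows "enumerated X \<tau> x \<longleftrightarrow> x \<in> X \<and> x \<in> ordered_matrices"
proof
  assume "enumerated X \<tau> x"
  then obtain b where b: "b \<in> leaves \<tau>" "subproblem X b = {x}"
    by (auto simp: enumerated_def)
  then have x: "x \<in> X" "x \<in> node_face b" by (auto simp: subproblem_def)
  obtain a where "orbitopal_fixing a b" "all_fixed b"
    using leaf_of_bb_subtree tree b(1) unfolding orbitopal_fixing_bb_tree_def by blast
  with x show "x \<in> X \<and> x \<in> ordered_matrices" using all_fixed_leaf_ordered by blast
next
  assume x: "x \<in> X \<and> x \<in> ordered_matrices"
  then have "x \<in> subproblem X root"
    using X binary_subset_unit_cube
    by (auto simp: subproblem_def root_def node_face_def cube_face_def)
  with x tree show "enumerated X \<tau> x"
    unfolding orbitopal_fixing_bb_tree_def by (blast intro: ordered_solution_enumerated)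
qed

theorem theorem4:
  fixes X :: "('m::{finite,linorder}, 'n::{finite,linorder}) real_matrix set"
    and c :: "('m, 'n) real_matrix \<Rightarrow> real"
    and \<tau> :: "('m, 'n) bb_tree"
  assumes "X \<subseteq> binary_matrices"
    and "linear c"
    and "column_symmetric X c"
    and "orbitopal_fixing_bb_tree X \<tau>"
  shows "\<forall>\<O> \<in> solution_orbits X. \<exists>!x. x \<in> \<O> \<and> enumerated X \<tau> x"
proof
  fix \<O>
  assume "\<O> \<in> solution_orbits X"
  then obtain x where "x \<in> X" and orbit: "\<O> = {permute_columns \<pi> x | \<pi>. \<pi> permutes UNIV}"
    by (auto simp: solution_orbits_def)
  have x: "x \<in> binary_matrices" using \<open>x \<in> X\<close> assms(1) by blast
  have "\<O> \<subseteq> X"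
    using \<open>x \<in> X\<close> assms(3) by (auto simp: orbit column_symmetric_def)
  then have enum: "y \<in> \<O> \<and> enumerated X \<tau> y \<longleftrightarrow> y \<in> \<O> \<and> y \<in> ordered_matrices" for y
    using enumerated_iff_ordered[OF assms(1,4)] by blast
  show "\<exists>!y. y \<in> \<O> \<and> enumerated X \<tau> y"
    unfolding enum
  proof (rule ex_ex1I)
    show "\<exists>y. y \<in> \<O> \<and> y \<in> ordered_matrices"
      using exists_ordered_permutation[OF x] by (auto simp: orbit)
  next
    fix y z
    assume "y \<in> \<O> \<and> y \<in> ordered_matrices" and "z \<in> \<O> \<and> z \<in> ordered_matrices"
    then show "y = z"
      using ordered_permutation_unique[OF x] by (auto simp: orbit)
  qed
qed

end
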